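(* Let $\mathbb F$ be a field of characteristic $0$, let $\mathcal E$ be a tame extended affine Lie algebra over $\mathbb F$, let $\mathcal K$ be its core, and set $\mathcal D=\mathcal E/\mathcal K$. Then $\mathcal K$ is central, i.e. $\operatorname{Cent}(\mathcal K)=\mathbb F\,\mathrm{id}$, and $$\operatorname{Cent}(\mathcal E)=\mathbb F\,\mathrm{id}\oplus\mathcal V(\mathcal K)\;\cong\;\mathbb F\,\mathrm{id}\oplus \operatorname{Hom}_{\mathcal D}(\mathcal D,Z(\mathcal K)).$$
   Context: For a Lie algebra $\mathcal L$ over $\mathbb F$, $\operatorname{Cent}(\mathcal L)=\{\chi\in\operatorname{End}_{\mathbb F}(\mathcal L)\mid \chi([x,y])=[x,\chi(y)]=[\chi(x),y]\ \forall x,y\in\mathcal L\}$ is the centroid, and $Z(\mathcal L)$ is the centre. Tame extended affine Lie algebra over $\mathbb F$: a Lie algebra $\mathcal E$ over $\mathbb F$ with a subalgebra $H$ such that: (1) $\mathcal E$ has a nondegenerate invariant symmetric bilinear form $(\cdot|\cdot)$; (2) $H$ is nonzero, finite-dimensional, and $\mathcal E=\bigoplus_{\alpha\in H^*}\mathcal E_\alpha$ with $\mathcal E_\alpha=\{x\mid [h,x]=\alpha(h)x\ \forall h\in H\}$ and $\mathcal E_0=H$. Put $R=\{\alpha\in H^*\mid \mathcal E_\alpha\neq0\}$ (the roots, including $0$). The restriction of the form to $H$ is nondegenerate and is transferred to $H^*$; a root is isotropic if $(\alpha|\alpha)=0$ (the set of these is $R^0$) and nonisotropic otherwise (set $R^{\times}$).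 (3) For $\alpha\in R^\times$ and $x\in \mathcal E_\alpha$, $\operatorname{ad}x$ is locally nilpotent; (4) $R^\times$ is not the union of two nonempty disjoint mutually orthogonal subsets; (5) the subgroup of $H^*$ generated by $R^0$ is free abelian of finite rank; (6) (tameness) with the core $\mathcal K$ defined as the ideal of $\mathcal E$ generated by the spaces $\mathcal E_\alpha$, $\alpha\in R^\times$, the centralizer of $\mathcal K$ in $\mathcal E$ satisfies $\mathcal C_{\mathcal E}(\mathcal K)=Z(\mathcal K)$. $\mathcal V(\mathcal K)=\{\chi\in\operatorname{Cent}(\mathcal E)\mid\chi(\mathcal K)=0\}$. Since $\mathcal K$ acts trivially on $Z(\mathcal K)$, the quotient $\mathcal D=\mathcal E/\mathcal K$ acts on $Z(\mathcal K)$ by $[a+\mathcal K,z]=[a,z]$; $\operatorname{Hom}_{\mathcal D}(\mathcal D,Z(\mathcal K))$ is the space of $\mathbb F$-linear maps $f:\mathcal D\to Z(\mathcal K)$ with $f([x,y])=[f(x),y]=[x,f(y)]$ for all $x,y\in\mathcal D$. *)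

theory Defs
  imports Complex_Main "HOL-Library.Function_Algebras" "HOL-Library.Set_Algebras"
    "HOL-Library.Product_Plus" "HOL-Algebra.Free_Abelian_Groups"
begin

section \<open>Vector space preliminaries\<close>

text \<open>
  Linear maps out of a subspace \<open>S\<close> are represented by total functions that vanish off \<open>S\<close>.
  With this convention equality, addition and scaling of such maps are the pointwise ones, and a
  linear map on \<open>S\<close> is represented by exactly one function.
\<close>

definition linear_on ::
    "('f \<Rightarrow> 'a \<Rightarrow> 'a) \<Rightarrow> ('f \<Rightarrow> 'b \<Rightarrow> 'b) \<Rightarrow> 'a::plus set \<Rightarrow> ('a \<Rightarrow> 'b::plus) \<Rightarrow> bool" where
  "linear_on s1 s2 S f \<longleftrightarrow>
     (\<forall>x\<in>S. \<forall>y\<in>S. f (x + y) = f x + f y) \<and> (\<forall>c. \<forall>x\<in>S. f (s1 c x) = s2 c (f x))"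

definition linear_iso_on ::
    "('f \<Rightarrow> 'a \<Rightarrow> 'a) \<Rightarrow> 'a::plus set \<Rightarrow> ('f \<Rightarrow> 'b \<Rightarrow> 'b) \<Rightarrow> 'b::plus set \<Rightarrow> ('a \<Rightarrow> 'b) \<Rightarrow> bool" where
  "linear_iso_on s1 V s2 W \<Phi> \<longleftrightarrow> linear_on s1 s2 V \<Phi> \<and> bij_betw \<Phi> V W"

definition scale_fun :: "('f \<Rightarrow> 'b \<Rightarrow> 'b) \<Rightarrow> 'f \<Rightarrow> ('a \<Rightarrow> 'b) \<Rightarrow> 'a \<Rightarrow> 'b" where
  "scale_fun s c f = (\<lambda>x. s c (f x))"

definition scale_prod ::
    "('f \<Rightarrow> 'a \<Rightarrow> 'a) \<Rightarrow> ('f \<Rightarrow> 'b \<Rightarrow> 'b) \<Rightarrow> 'f \<Rightarrow> 'a \<times> 'b \<Rightarrow> 'a \<times> 'b" where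
  "scale_prod s1 s2 c p = (s1 c (fst p), s2 c (snd p))"

definition dual_space :: "('f \<Rightarrow> 'e \<Rightarrow> 'e) \<Rightarrow> 'e set \<Rightarrow> ('e::ab_group_add \<Rightarrow> 'f::field) set" where
  "dual_space scale H = {\<alpha>. linear_on scale (*) H \<alpha> \<and> (\<forall>x. x \<notin> H \<longrightarrow> \<alpha> x = 0)}"

text \<open>The whole space is the internal direct sum of the subspaces \<open>V i\<close> for \<open>i \<in> I\<close>.\<close>

definition is_direct_sum_family :: "'i set \<Rightarrow> ('i \<Rightarrow> 'e::ab_group_add set) \<Rightarrow> bool" where
  "is_direct_sum_family I V \<longleftrightarrow>
     (\<forall>x. \<exists>!u. (\<forall>i\<in>I. u i \<in> V i) \<and> (\<forall>i. i \<notin> I \<longrightarrow> u i = 0) \<and> finite {i. u i \<noteq> 0} \<and>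
              x = (\<Sum>i | u i \<noteq> 0. u i))"


section \<open>Lie algebras\<close>

locale lie_algebra = vector_space scale
  for scale :: "'f::field \<Rightarrow> 'e::ab_group_add \<Rightarrow> 'e" +
  fixes br :: "'e \<Rightarrow> 'e \<Rightarrow> 'e"
  assumes br_add_left: "br (x + y) z = br x z + br y z"
    and br_add_right: "br x (y + z) = br x y + br x z"
    and br_scale_left: "br (scale c x) y = scale c (br x y)"
    and br_scale_right: "br x (scale c y) = scale c (br x y)"
    and br_self: "br x x = 0"
    and jacobi: "br x (br y z) + br y (br z x) + br z (br x y) = 0"

definition lie_subalgebra ::
    "('f::field \<Rightarrow> 'e::ab_group_add \<Rightarrow> 'e) \<Rightarrow> ('e \<Rightarrow> 'e \<Rightarrow> 'e) \<Rightarrow> 'e set \<Rightarrow> bool" where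
  "lie_subalgebra scale br S \<longleftrightarrow> module.subspace scale S \<and> (\<forall>x\<in>S. \<forall>y\<in>S. br x y \<in> S)"

definition lie_ideal ::
    "('f::field \<Rightarrow> 'e::ab_group_add \<Rightarrow> 'e) \<Rightarrow> ('e \<Rightarrow> 'e \<Rightarrow> 'e) \<Rightarrow> 'e set \<Rightarrow> bool" where
  "lie_ideal scale br I \<longleftrightarrow> module.subspace scale I \<and> (\<forall>x. \<forall>y\<in>I. br x y \<in> I)"

definition centralizer :: "('e \<Rightarrow> 'e \<Rightarrow> 'e::zero) \<Rightarrow> 'e set \<Rightarrow> 'e set" where
  "centralizer br S = {x. \<forall>y\<in>S. br x y = 0}"

definition centre :: "('e \<Rightarrow> 'e \<Rightarrow> 'e::zero) \<Rightarrow> 'e set \<Rightarrow> 'e set" where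
  "centre br S = {z\<in>S. \<forall>y\<in>S. br z y = 0}"

text \<open>The centroid of the subalgebra \<open>S\<close>; \<open>S = UNIV\<close> gives the centroid of the whole algebra.\<close>

definition centroid ::
    "('f \<Rightarrow> 'e \<Rightarrow> 'e) \<Rightarrow> ('e \<Rightarrow> 'e \<Rightarrow> 'e) \<Rightarrow> 'e::ab_group_add set \<Rightarrow> ('e \<Rightarrow> 'e) set" where
  "centroid scale br S =
     {\<chi>. linear_on scale scale S \<chi> \<and> \<chi> ` S \<subseteq> S \<and> (\<forall>x. x \<notin> S \<longrightarrow> \<chi> x = 0) \<and>
         (\<forall>x\<in>S. \<forall>y\<in>S. \<chi> (br x y) = br x (\<chi> y) \<and> \<chi> (br x y) = br (\<chi> x) y)}"

definition scalar_maps :: "('f \<Rightarrow> 'e \<Rightarrow> 'e) \<Rightarrow> 'e::zero set \<Rightarrow> ('e \<Rightarrow> 'e) set" where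
  "scalar_maps scale S = range (\<lambda>c x. if x \<in> S then scale c x else 0)"

definition centroid_vanishing ::
    "('f \<Rightarrow> 'e \<Rightarrow> 'e) \<Rightarrow> ('e \<Rightarrow> 'e \<Rightarrow> 'e) \<Rightarrow> 'e::ab_group_add set \<Rightarrow> ('e \<Rightarrow> 'e) set" where
  "centroid_vanishing scale br K = {\<chi> \<in> centroid scale br UNIV. \<forall>x\<in>K. \<chi> x = 0}"

text \<open>
  \<open>Hom\<^sub>D(D, Z(K))\<close> for \<open>D = E/K\<close>, with \<open>K\<close> an ideal. The elements of \<open>D\<close> are the cosets
  \<open>a +o K\<close>, and the functions below vanish on sets that are not cosets. The vector space operations
  and bracket of \<open>D\<close>, and its action on \<open>Z(K)\<close>, are computed on representatives, so quantifying over
  all elements of \<open>D\<close> amounts to quantifying over all representatives.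
\<close>

definition hom_quotient_centre ::
    "('f \<Rightarrow> 'e \<Rightarrow> 'e) \<Rightarrow> ('e \<Rightarrow> 'e \<Rightarrow> 'e) \<Rightarrow> 'e::ab_group_add set \<Rightarrow> ('e set \<Rightarrow> 'e) set" where
  "hom_quotient_centre scale br K =
     {f. (\<forall>X. X \<notin> range (\<lambda>a. a +o K) \<longrightarrow> f X = 0) \<and>
         (\<forall>a. f (a +o K) \<in> centre br K) \<and>
         (\<forall>a b. f ((a + b) +o K) = f (a +o K) + f (b +o K)) \<and>
         (\<forall>c a. f (scale c a +o K) = scale c (f (a +o K))) \<and>
         (\<forall>a b. f (br a b +o K) = br (f (a +o K)) b \<and> f (br a b +o K) = br a (f (b +o K)))}"


section \<open>Roots and core\<close>

definition root_space ::
    "('f \<Rightarrow> 'e \<Rightarrow> 'e) \<Rightarrow> ('e \<Rightarrow> 'e \<Rightarrow> 'e) \<Rightarrow> 'e set \<Rightarrow> ('e \<Rightarrow> 'f) \<Rightarrow> 'e set" where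
  "root_space scale br H \<alpha> = {x. \<forall>h\<in>H. br h x = scale (\<alpha> h) x}"

definition roots ::
    "('f::field \<Rightarrow> 'e::ab_group_add \<Rightarrow> 'e) \<Rightarrow> ('e \<Rightarrow> 'e \<Rightarrow> 'e) \<Rightarrow> 'e set \<Rightarrow> ('e \<Rightarrow> 'f) set" where
  "roots scale br H = {\<alpha> \<in> dual_space scale H. root_space scale br H \<alpha> \<noteq> {0}}"

text \<open>
  The form on \<open>H\<^sup>*\<close> transferred from \<open>H\<close>. The description operator is meaningful because the
  restriction of the form to \<open>H\<close> is nondegenerate; this follows from \<open>E\<^sub>0 = H\<close>, invariance and
  nondegeneracy on the whole algebra.
\<close>

definition dual_vector :: "('e \<Rightarrow> 'e \<Rightarrow> 'f) \<Rightarrow> 'e set \<Rightarrow> ('e \<Rightarrow> 'f) \<Rightarrow> 'e" where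
  "dual_vector form H \<alpha> = (THE t. t \<in> H \<and> (\<forall>h\<in>H. form t h = \<alpha> h))"

definition dual_form :: "('e \<Rightarrow> 'e \<Rightarrow> 'f) \<Rightarrow> 'e set \<Rightarrow> ('e \<Rightarrow> 'f) \<Rightarrow> ('e \<Rightarrow> 'f) \<Rightarrow> 'f" where
  "dual_form form H \<alpha> \<beta> = form (dual_vector form H \<alpha>) (dual_vector form H \<beta>)"

definition isotropic_roots ::
    "('f::field \<Rightarrow> 'e::ab_group_add \<Rightarrow> 'e) \<Rightarrow> ('e \<Rightarrow> 'e \<Rightarrow> 'e) \<Rightarrow> ('e \<Rightarrow> 'e \<Rightarrow> 'f) \<Rightarrow> 'e set \<Rightarrow>
      ('e \<Rightarrow> 'f) set" where
  "isotropic_roots scale br form H = {\<alpha> \<in> roots scale br H. dual_form form H \<alpha> \<alpha> = 0}"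

definition nonisotropic_roots ::
    "('f::field \<Rightarrow> 'e::ab_group_add \<Rightarrow> 'e) \<Rightarrow> ('e \<Rightarrow> 'e \<Rightarrow> 'e) \<Rightarrow> ('e \<Rightarrow> 'e \<Rightarrow> 'f) \<Rightarrow> 'e set \<Rightarrow>
      ('e \<Rightarrow> 'f) set" where
  "nonisotropic_roots scale br form H = {\<alpha> \<in> roots scale br H. dual_form form H \<alpha> \<alpha> \<noteq> 0}"

definition core ::
    "('f::field \<Rightarrow> 'e::ab_group_add \<Rightarrow> 'e) \<Rightarrow> ('e \<Rightarrow> 'e \<Rightarrow> 'e) \<Rightarrow> ('e \<Rightarrow> 'e \<Rightarrow> 'f) \<Rightarrow> 'e set \<Rightarrow> 'e set" where
  "core scale br form H =
     lie_ideal scale br hull (\<Union>\<alpha>\<in>nonisotropic_roots scale br form H. root_space scale br H \<alpha>)"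

definition dual_group ::
    "('f \<Rightarrow> 'e \<Rightarrow> 'e) \<Rightarrow> 'e set \<Rightarrow> ('e::ab_group_add \<Rightarrow> 'f::field) monoid" where
  "dual_group scale H = \<lparr>carrier = dual_space scale H, monoid.mult = (+), one = 0\<rparr>"


section \<open>Tame extended affine Lie algebras\<close>

locale tame_eala = lie_algebra scale br
  for scale :: "'f::field_char_0 \<Rightarrow> 'e::ab_group_add \<Rightarrow> 'e" and br :: "'e \<Rightarrow> 'e \<Rightarrow> 'e" +
  fixes form :: "'e \<Rightarrow> 'e \<Rightarrow> 'f" and H :: "'e set"
  assumes form_add_left: "form (x + y) z = form x z + form y z"
    and form_scale_left: "form (scale c x) y = c * form x y"
    and form_sym: "form x y = form y x"
    and form_invariant: "form (br x y) z = form x (br y z)"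
    and form_nondegenerate: "(\<And>y. form x y = 0) \<Longrightarrow> x = 0"
    and H_subalgebra: "lie_subalgebra scale br H"
    and H_nonzero: "H \<noteq> {0}"
    and H_finite_dim: "\<exists>B. finite B \<and> module.span scale B = H"
    and root_decomposition: "is_direct_sum_family (dual_space scale H) (root_space scale br H)"
    and zero_root_space: "root_space scale br H 0 = H"
    and ad_locally_nilpotent:
      "\<lbrakk>\<alpha> \<in> nonisotropic_roots scale br form H; x \<in> root_space scale br H \<alpha>\<rbrakk>
        \<Longrightarrow> \<exists>n. (br x ^^ n) y = 0"
    and nonisotropic_connected:
      "\<not> (\<exists>A B. A \<noteq> {} \<and> B \<noteq> {} \<and> A \<inter> B = {} \<and> A \<union> B = nonisotropic_roots scale br form H \<and>
               (\<forall>\<alpha>\<in>A. \<forall>\<beta>\<in>B. dual_form form H \<alpha> \<beta> = 0))"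
    and isotropic_free_finite_rank:
      "\<exists>S :: nat set. finite S \<and>
         subgroup_generated (dual_group scale H) (isotropic_roots scale br form H)
           \<cong> free_Abelian_group S"
    and tame:
      "centralizer br (core scale br form H) = centre br (core scale br form H)"

end

theory Submission
  imports Defs
begin

text \<open>
  Let \<open>\<chi>\<close> be in the centroid of the core \<open>K\<close>, let \<open>\<alpha>\<close> be a nonisotropic root and \<open>x \<in> E\<^sub>\<alpha>\<close>. If
  \<open>(\<chi> x | b) \<noteq> 0\<close> for some \<open>b \<in> E\<^sub>-\<^sub>\<beta>\<close>, then, as \<open>\<chi>\<close> commutes with \<open>ad t\<^sub>\<alpha>\<close>, \<open>\<beta>\<close> and
  \<open>\<alpha>\<close> agree at \<open>t\<^sub>\<alpha>\<close>, so \<open>b \<in> K\<close>; the \<open>H\<close>-component of \<open>[\<chi> x, b] = [x, \<chi> b]\<close> then makes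
  \<open>\<beta>\<close> proportional to \<open>\<alpha>\<close>, hence equal to \<open>\<alpha>\<close>. So \<open>\<chi>\<close> preserves the one-dimensional space
  \<open>E\<^sub>\<alpha>\<close> and acts on it and on \<open>t\<^sub>\<alpha>\<close> by a scalar \<open>c\<^sub>\<alpha>\<close>. Applying \<open>\<chi>\<close> to \<open>[t\<^sub>\<alpha>, E\<^sub>\<beta>]\<close>
  gives \<open>c\<^sub>\<alpha> = c\<^sub>\<beta>\<close> whenever \<open>(\<alpha> | \<beta>) \<noteq> 0\<close>, so by connectedness \<open>\<chi>\<close> is a scalar on the
  generators of \<open>K\<close>, and therefore on \<open>K\<close>.

  An element of the centroid of \<open>E\<close> preserves \<open>K\<close>, so subtracting a scalar makes it vanish on
  \<open>K\<close>. A centroid element vanishing on \<open>K\<close> has its image in the centralizer of \<open>K\<close>, which is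
  \<open>Z(K)\<close> by tameness, and is the same thing as a map \<open>E/K \<rightarrow> Z(K)\<close>.
\<close>

section \<open>Centroids of Lie algebras\<close>

context lie_algebra
begin

section \<open>Elementary bracket identities\<close>

lemma br_zero_left [simp]: "br 0 y = 0"
  using br_scale_left[of 0 0 y] by simp

lemma br_zero_right [simp]: "br x 0 = 0"
  using br_scale_right[of x 0 0] by simp

lemma br_minus_left: "br (- x) y = - br x y"
  using br_scale_left[of "- 1" x y] by simp

lemma br_minus_right: "br x (- y) = - br x y"
  using br_scale_right[of x "- 1" y] by simp

lemma br_diff_left: "br (x - y) z = br x z - br y z"
  using br_add_left[of x "- y" z] by (simp add: br_minus_left)

lemma br_diff_right: "br x (y - z) = br x y - br x z"
  using br_add_right[of x y "- z"] by (simp add: br_minus_right)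

lemma br_anticommute: "br x y = - br y x"
proof -
  have "br (x + y) (x + y) = br x x + br y y + (br x y + br y x)"
    by (simp only: br_add_left br_add_right ac_simps)
  then have "br x y + br y x = 0"
    by (simp only: br_self add_0)
  then show ?thesis
    by (simp add: eq_neg_iff_add_eq_0)
qed

lemma br_leibniz: "br x (br y z) = br (br x y) z + br y (br x z)"
proof -
  have "br y (br z x) = - br y (br x z)"
    by (metis br_anticommute br_minus_right)
  moreover have "br z (br x y) = - br (br x y) z"
    by (rule br_anticommute)
  ultimately show ?thesis
    using jacobi[of x y z] by (simp add: algebra_simps)
qed

section \<open>Generated ideals and the centroidal maps on them\<close>

lemma lie_ideal_hull: "lie_ideal scale br (lie_ideal scale br hull G)"
  by (rule hull_in) (auto simp: lie_ideal_def subspace_def)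

text \<open>The elements of the hull that satisfy \<open>P\<close> form an ideal containing
  \<open>G\<close>, hence exhaust the hull. Membership in the hull stays available in each case, so
  \<open>P\<close> may speak of maps that are controlled only there.\<close>

lemma lie_ideal_hull_induct [consumes 1, case_names gen zero add scale br]:
  assumes "x \<in> lie_ideal scale br hull G"
    and "\<And>g. g \<in> G \<Longrightarrow> P g"
    and "P 0"
    and "\<And>x y. \<lbrakk>x \<in> lie_ideal scale br hull G; y \<in> lie_ideal scale br hull G; P x; P y\<rbrakk> \<Longrightarrow> P (x + y)"
    and "\<And>c x. \<lbrakk>x \<in> lie_ideal scale br hull G; P x\<rbrakk> \<Longrightarrow> P (scale c x)"
    and "\<And>x y. \<lbrakk>y \<in> lie_ideal scale br hull G; P y\<rbrakk> \<Longrightarrow> P (br x y)"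
  shows "P x"
proof -
  let ?K = "lie_ideal scale br hull G"
  have "lie_ideal scale br {x \<in> ?K. P x}"
    using lie_ideal_hull[of G] assms(3-6) by (auto simp: lie_ideal_def subspace_def)
  moreover have "G \<subseteq> {x \<in> ?K. P x}"
    using hull_subset[of G "lie_ideal scale br"] assms(2) by auto
  ultimately have "?K \<subseteq> {x \<in> ?K. P x}"
    by (rule hull_minimal[rotated])
  then show ?thesis
    using assms(1) by blast
qed

text \<open>This drops the convention of vanishing off \<open>K\<close>, so a map of the whole
  algebra can be restricted to an ideal, and scalars or commutators with \<open>br y\<close> can be
  formed, without cutting the result off.\<close>

definition centroidal_on :: "'e set \<Rightarrow> ('e \<Rightarrow> 'e) \<Rightarrow> bool" where
  "centroidal_on K \<chi> \<longleftrightarrow> linear_on scale scale K \<chi> \<and> \<chi> ` K \<subseteq> K \<and>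
     (\<forall>x\<in>K. \<forall>y\<in>K. \<chi> (br x y) = br x (\<chi> y) \<and> \<chi> (br x y) = br (\<chi> x) y)"

lemma centroidal_onD:
  assumes "centroidal_on K \<chi>" "x \<in> K"
  shows "\<chi> (scale c x) = scale c (\<chi> x)" "\<chi> x \<in> K"
    "y \<in> K \<Longrightarrow> \<chi> (x + y) = \<chi> x + \<chi> y"
    "y \<in> K \<Longrightarrow> \<chi> (br x y) = br x (\<chi> y)"
    "y \<in> K \<Longrightarrow> \<chi> (br x y) = br (\<chi> x) y"
  using assms unfolding centroidal_on_def linear_on_def by blast+

lemma centroid_iff: "\<chi> \<in> centroid scale br S \<longleftrightarrow> centroidal_on S \<chi> \<and> (\<forall>x. x \<notin> S \<longrightarrow> \<chi> x = 0)"
  by (auto simp: centroid_def centroidal_on_def)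

lemma centroidal_on_diff_scale:
  assumes "centroidal_on K \<chi>" "lie_ideal scale br K"
  shows "centroidal_on K (\<lambda>x. \<chi> x - scale c x)"
  using assms centroidal_onD[OF assms(1)] subspace_diff[of K] subspace_scale[of K]
  by (auto simp: centroidal_on_def linear_on_def lie_ideal_def br_diff_left br_diff_right
      br_scale_left br_scale_right scale_right_distrib scale_right_diff_distrib mult.commute)

text \<open>Here \<open>y\<close> ranges over the whole algebra. Since \<open>br y\<close> acts on
  \<open>K\<close> as a derivation, expanding both terms at a bracket of \<open>a\<close> and
  \<open>b\<close> yields a common mixed term, which cancels in the commutator.\<close>

lemma centroidal_on_derivation:
  assumes "centroidal_on K \<chi>" "lie_ideal scale br K"
  shows "centroidal_on K (\<lambda>x. br y (\<chi> x) - \<chi> (br y x))"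
proof -
  have K: "br z x \<in> K" if "x \<in> K" for x z
    using assms(2) that by (auto simp: lie_ideal_def)
  have sub: "subspace K"
    using assms(2) by (auto simp: lie_ideal_def)
  note D = centroidal_onD[OF assms(1)]
  have 1: "br y (\<chi> (br a b)) - \<chi> (br y (br a b)) = br (br y (\<chi> a) - \<chi> (br y a)) b"
    if "a \<in> K" "b \<in> K" for a b
  proof -
    have "\<chi> (br y (br a b)) = br (\<chi> (br y a)) b + br (\<chi> a) (br y b)"
      using that by (simp add: br_leibniz[of y a] D(3,5) K)
    moreover have "br y (\<chi> (br a b)) = br (br y (\<chi> a)) b + br (\<chi> a) (br y b)"
      using that by (simp add: D(5) br_leibniz[of y "\<chi> a"])
    ultimately show ?thesis
      by (simp add: br_diff_left)
  qed
  have 2: "br y (\<chi> (br a b)) - \<chi> (br y (br a b)) = br a (br y (\<chi> b) - \<chi> (br y b))"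
    if "a \<in> K" "b \<in> K" for a b
  proof -
    have "\<chi> (br y (br a b)) = br (br y a) (\<chi> b) + br a (\<chi> (br y b))"
      using that by (simp add: br_leibniz[of y a] D(3,4) K)
    moreover have "br y (\<chi> (br a b)) = br (br y a) (\<chi> b) + br a (br y (\<chi> b))"
      using that by (simp add: D(4) br_leibniz[of y a])
    ultimately show ?thesis
      by (simp add: br_diff_right)
  qed
  show ?thesis
    using 1 2 sub K D
    by (auto simp: centroidal_on_def linear_on_def br_add_right br_scale_right
        scale_right_diff_distrib intro!: subspace_diff)
qed

text \<open>
  The maps in question are closed under \<open>\<chi> \<mapsto> [ad y, \<chi>]\<close> for \<open>y\<close> in the whole algebra, so their
  common kernel is an ideal of the whole algebra.
\<close>

lemma centroidal_on_eq_0: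
  assumes gen: "\<And>g. g \<in> G \<Longrightarrow> \<exists>a\<in>G. \<exists>b\<in>G. \<exists>c\<in>lie_ideal scale br hull G. g = br (br a c) b"
    and "x \<in> lie_ideal scale br hull G"
    and "centroidal_on (lie_ideal scale br hull G) \<chi>"
    and "\<And>g. g \<in> G \<Longrightarrow> \<chi> g = 0"
  shows "\<chi> x = 0"
  using assms(2-)
proof (induction arbitrary: \<chi> rule: lie_ideal_hull_induct)
  case (gen g)
  then show ?case by blast
next
  case zero
  have "(0::'e) \<in> lie_ideal scale br hull G"
    using lie_ideal_hull[of G] by (auto simp: lie_ideal_def subspace_def)
  from centroidal_onD(1)[OF zero(1) this, of 0] show ?case
    by simp
next
  case (add x y)
  have "\<chi> (x + y) = \<chi> x + \<chi> y"
    using centroidal_onD(3)[OF add(5) add(1,2)] .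
  then show ?case
    using add.IH[OF add(5,6)] by simp
next
  case (scale c x)
  then show ?case
    using centroidal_onD(1)[OF scale(3,1)] by simp
next
  case (br y x)
  let ?K = "lie_ideal scale br hull G"
  note D = centroidal_onD[OF br(3)]
  have K: "br z x \<in> ?K" "br x z \<in> ?K" if "x \<in> ?K" for x z
  proof -
    show *: "br z x \<in> ?K"
      using lie_ideal_hull[of G] that by (auto simp: lie_ideal_def)
    show "br x z \<in> ?K"
      using * lie_ideal_hull[of G] by (metis br_anticommute lie_ideal_def subspace_neg)
  qed
  have GK: "g \<in> ?K" if "g \<in> G" for g
    using that by (rule hull_inc)
  \<comment> \<open>As \<open>y\<close> may lie outside \<open>K\<close>, \<chi> cannot simply be
    moved past \<open>br y\<close>. Writing \<open>g\<close> as an iterated bracket and expanding by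
    Leibniz lets \<chi> act on \<open>b\<close> in one summand and on \<open>a\<close> in the other,
    and it kills both.\<close>
  have "\<chi> (br y g) = 0" if "g \<in> G" for g
  proof -
    obtain a b c where *: "a \<in> G" "b \<in> G" "c \<in> ?K" "g = br (br a c) b"
      using gen \<open>g \<in> G\<close> by blast
    have "\<chi> (br y g) = \<chi> (br (br y (br a c)) b) + \<chi> (br (br a c) (br y b))"
      using * by (simp add: br_leibniz[of y "br a c" b] D K GK)
    also have "\<dots> = br (br y (br a c)) (\<chi> b) + br (br (\<chi> a) c) (br y b)"
      using * by (simp add: D(4)[of "br y (br a c)"] D(5)[of "br a c"] D(5)[of a] K GK)
    finally show ?thesis
      using * br(4) by simp
  qed
  \<comment> \<open>The induction hypothesis holds for every centroidal map killing
    \<open>G\<close>; here it is applied to the commutator of \<open>br y\<close> with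
    \<chi>.\<close>
  then have "br y (\<chi> x) - \<chi> (br y x) = 0"
    using br(2)[OF centroidal_on_derivation[OF br(3) lie_ideal_hull, of y]] br(4) by simp
  moreover have "\<chi> x = 0"
    using br(2)[OF br(3,4)] .
  ultimately show ?case
    by simp
qed

text \<open>A generator is a bracket with right factor \<open>b\<close> in \<open>G\<close>. Moving
  \<chi> into the left factor leaves \<open>b\<close> in place, so the image stays in the
  ideal.\<close>

lemma centroidal_maps_into_hull:
  assumes gen: "\<And>g. g \<in> G \<Longrightarrow> \<exists>a\<in>G. \<exists>b\<in>G. \<exists>c\<in>lie_ideal scale br hull G. g = br (br a c) b"
    and "centroidal_on UNIV \<chi>"
    and "x \<in> lie_ideal scale br hull G"
  shows "\<chi> x \<in> lie_ideal scale br hull G"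
proof -
  let ?K = "lie_ideal scale br hull G"
  note D = centroidal_onD[OF assms(2) UNIV_I]
  have sub: "subspace ?K" and K: "\<And>x y. y \<in> ?K \<Longrightarrow> br x y \<in> ?K"
    using lie_ideal_hull[of G] by (auto simp: lie_ideal_def)
  show ?thesis
    using assms(3)
  proof (induction rule: lie_ideal_hull_induct)
    case (gen g)
    then obtain a b c where "b \<in> G" "g = br (br a c) b"
      using assms(1) by blast
    then show ?case
      by (simp add: D(5) K hull_inc)
  next
    case zero
    show ?case
      using D(1)[of 0] subspace_0[OF sub] by simp
  next
    case (br y x)
    then show ?case
      by (simp add: D(4) K)
  qed (use sub in \<open>auto simp: D subspace_add subspace_scale\<close>)
qed

end

section \<open>Root spaces\<close>

context tame_eala
begin

abbreviation "rs \<equiv> root_space scale br H"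
abbreviation "nonisotropic \<equiv> nonisotropic_roots scale br form H"
abbreviation "gens \<equiv> \<Union>\<alpha>\<in>nonisotropic. rs \<alpha>"
abbreviation "K \<equiv> core scale br form H"
abbreviation "dual \<equiv> dual_vector form H"

lemma form_zero_left [simp]: "form 0 y = 0"
  using form_scale_left[of 0 0 y] by simp

lemma form_scale_right: "form x (scale c y) = c * form x y"
  by (metis form_scale_left form_sym)

lemma form_sum_left: "form (\<Sum>i\<in>A. u i) y = (\<Sum>i\<in>A. form (u i) y)"
  by (induction A rule: infinite_finite_induct) (auto simp: form_add_left)

lemma rs_bracket: "x \<in> rs \<alpha> \<Longrightarrow> h \<in> H \<Longrightarrow> br h x = scale (\<alpha> h) x"
  by (simp add: root_space_def)

lemma rs_subspace: "subspace (rs \<alpha>)"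
  by (auto simp: subspace_def root_space_def br_add_right br_scale_right scale_right_distrib
      mult.commute)

lemma br_rs:
  assumes "x \<in> rs \<alpha>" "y \<in> rs \<beta>"
  shows "br x y \<in> rs (\<alpha> + \<beta>)"
  using assms
  by (auto simp: root_space_def br_leibniz[of _ x y] br_scale_left br_scale_right scale_left_distrib)

text \<open>The pairing with \<open>h\<close> in place of the \<open>H\<close>-component of \<open>[x, b]\<close>.\<close>

lemma form_br_rs:
  assumes "b \<in> rs (- \<beta>)" "h \<in> H"
  shows "form (br x b) h = \<beta> h * form x b"
proof -
  have "br b h = scale (\<beta> h) b"
    using assms rs_bracket[of b "- \<beta>" h] br_anticommute[of b h] by simp
  then show ?thesis
    by (simp add: form_invariant form_scale_right)
qed

text \<open>Invariance moves each \<open>h\<close> in \<open>H\<close> from \<open>x\<close> to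
  \<open>y\<close>, and comparing eigenvalues gives \<beta>(h) = -\<alpha>(h). Off \<open>H\<close>
  both functionals vanish by convention.\<close>

lemma rs_orthogonal:
  assumes "\<alpha> \<in> dual_space scale H" "\<beta> \<in> dual_space scale H"
    and "x \<in> rs \<alpha>" "y \<in> rs \<beta>" "form x y \<noteq> 0"
  shows "\<beta> = - \<alpha>"
proof
  fix h
  show "\<beta> h = (- \<alpha>) h"
  proof (cases "h \<in> H")
    case True
    have "form (br x h) y = form x (br h y)"
      by (rule form_invariant)
    then have "\<beta> h * form x y = - \<alpha> h * form x y"
      using assms True br_anticommute[of x h] form_scale_left[of "- \<alpha> h" x y]
      by (simp add: rs_bracket form_scale_right)
    then show ?thesis
      using assms(5) by (simp only: mult_cancel_right) simp
  next
    case False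
    then show ?thesis
      using assms(1,2) by (simp add: dual_space_def)
  qed
qed

lemma rs_decomposition:
  obtains u where "finite {\<beta>. u \<beta> \<noteq> 0}" "\<And>\<beta>. u \<beta> \<in> rs \<beta>"
    "\<And>\<beta>. u \<beta> \<noteq> 0 \<Longrightarrow> \<beta> \<in> dual_space scale H" "x = (\<Sum>\<beta> | u \<beta> \<noteq> 0. u \<beta>)"
proof -
  obtain u where "\<forall>i\<in>dual_space scale H. u i \<in> rs i" "\<forall>i. i \<notin> dual_space scale H \<longrightarrow> u i = 0"
    "finite {i. u i \<noteq> 0}" "x = (\<Sum>i | u i \<noteq> 0. u i)"
    using root_decomposition unfolding is_direct_sum_family_def by blast
  moreover from this have "u \<beta> \<in> rs \<beta>" for \<beta>
    using subspace_0[OF rs_subspace, of \<beta>] by (cases "\<beta> \<in> dual_space scale H") auto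
  ultimately show ?thesis
    using that by blast
qed

lemma uminus_dual_space: "\<alpha> \<in> dual_space scale H \<Longrightarrow> - \<alpha> \<in> dual_space scale H"
  by (auto simp: dual_space_def linear_on_def)

text \<open>Nondegeneracy supplies some partner of \<open>x\<close>; by orthogonality only its
  component of weight -\<alpha> contributes to the pairing, and this component is then
  normalised.\<close>

lemma rs_dual_element:
  assumes "\<alpha> \<in> dual_space scale H" "x \<in> rs \<alpha>" "x \<noteq> 0"
  obtains y where "y \<in> rs (- \<alpha>)" "form x y = 1"
proof -
  obtain y where y: "form x y \<noteq> 0"
    using form_nondegenerate assms(3) by blast
  obtain u where u: "\<And>\<beta>. u \<beta> \<in> rs \<beta>"
    "\<And>\<beta>. u \<beta> \<noteq> 0 \<Longrightarrow> \<beta> \<in> dual_space scale H" "y = (\<Sum>\<beta> | u \<beta> \<noteq> 0. u \<beta>)"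
    using rs_decomposition[of y] by metis
  have "form x y = (\<Sum>\<beta> | u \<beta> \<noteq> 0. form x (u \<beta>))"
    unfolding u(3) by (subst (1 2) form_sym) (rule form_sum_left)
  with y obtain \<beta> where \<beta>: "u \<beta> \<noteq> 0" "form x (u \<beta>) \<noteq> 0"
    by (metis (mono_tags, lifting) mem_Collect_eq sum.neutral)
  then have "\<beta> = - \<alpha>"
    using rs_orthogonal assms u by blast
  then show ?thesis
    using that[of "scale (1 / form x (u \<beta>)) (u \<beta>)"] u(1)[of \<beta>] \<beta>(2) subspace_scale[OF rs_subspace]
    by (simp add: form_scale_right)
qed

text \<open>This tests weights through the form alone. A nonzero component \<open>u \<beta>\<close>
  pairs to 1 with some \<open>b\<close> of weight -\<beta>; the other components are orthogonal to
  \<open>b\<close>, so \<open>x\<close> itself detects \<beta>.\<close>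

lemma mem_rsI:
  assumes "\<And>\<beta> b. \<lbrakk>\<beta> \<in> dual_space scale H; b \<in> rs (- \<beta>); form x b \<noteq> 0\<rbrakk> \<Longrightarrow> \<beta> = \<alpha>"
  shows "x \<in> rs \<alpha>"
proof -
  obtain u where u: "finite {\<beta>. u \<beta> \<noteq> 0}" "\<And>\<beta>. u \<beta> \<in> rs \<beta>"
    "\<And>\<beta>. u \<beta> \<noteq> 0 \<Longrightarrow> \<beta> \<in> dual_space scale H" "x = (\<Sum>\<beta> | u \<beta> \<noteq> 0. u \<beta>)"
    using rs_decomposition[of x] by metis
  have "\<beta> = \<alpha>" if \<beta>: "u \<beta> \<noteq> 0" for \<beta>
  proof -
    obtain b where b: "b \<in> rs (- \<beta>)" "form (u \<beta>) b = 1"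
      using rs_dual_element[OF u(3)[OF \<beta>] u(2) \<beta>] .
    have "form (u \<gamma>) b = 0" if "u \<gamma> \<noteq> 0" "\<gamma> \<noteq> \<beta>" for \<gamma>
      using rs_orthogonal[OF u(3)[OF that(1)] uminus_dual_space[OF u(3)[OF \<beta>]] u(2) b(1)] that(2)
      by (metis neg_equal_iff_equal)
    then have "(\<Sum>\<gamma> | u \<gamma> \<noteq> 0. form (u \<gamma>) b) = (\<Sum>\<gamma> \<in> {\<beta>}. form (u \<gamma>) b)"
      by (intro sum.mono_neutral_right) (use u(1) \<beta> in auto)
    then have "form x b = 1"
      using b(2) by (subst u(4)) (simp add: form_sum_left)
    then show ?thesis
      using assms[OF u(3)[OF \<beta>] b(1)] by simp
  qed
  then have "x = (\<Sum>\<beta>\<in>{\<alpha>}. u \<beta>)"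
    by (subst u(4), intro sum.mono_neutral_left) auto
  then show ?thesis
    using u(2) by simp
qed

section \<open>The form on \<open>H\<close> and the vectors representing roots\<close>

lemma zero_in_dual_space: "0 \<in> dual_space scale H"
  by (auto simp: dual_space_def linear_on_def)

text \<open>\<open>H\<close> is the root space of weight 0, which is its own partner under the
  form.\<close>

lemma H_form_nondegenerate:
  assumes "x \<in> H" "\<And>h. h \<in> H \<Longrightarrow> form x h = 0"
  shows "x = 0"
proof (rule ccontr)
  assume "x \<noteq> 0"
  then obtain y where "y \<in> rs (- 0)" "form x y = 1"
    using rs_dual_element[OF zero_in_dual_space] assms(1) zero_root_space by blast
  then show False
    using assms(2)[of y] zero_root_space by simp
qed

lemma dual_vector_eqI:
  assumes "t \<in> H" "\<And>h. h \<in> H \<Longrightarrow> form t h = \<alpha> h"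
  shows "dual \<alpha> = t"
  unfolding dual_vector_def
proof (rule the_equality)
  fix s
  assume s: "s \<in> H \<and> (\<forall>h\<in>H. form s h = \<alpha> h)"
  have "s + scale (- 1) t \<in> H"
    using s assms(1) H_subalgebra unfolding lie_subalgebra_def subspace_def by blast
  then have "s + scale (- 1) t = 0"
    by (rule H_form_nondegenerate) (use s assms(2) in \<open>simp only: form_add_left form_scale_left, simp\<close>)
  then show "s = t"
    by simp
qed (use assms in auto)

lemma br_opposite_in_H: "x \<in> rs \<alpha> \<Longrightarrow> y \<in> rs (- \<alpha>) \<Longrightarrow> br x y \<in> H"
  using br_rs[of x \<alpha> y "- \<alpha>"] zero_root_space by simp

lemma br_opposite_eq_dual:
  assumes "x \<in> rs \<alpha>" "y \<in> rs (- \<alpha>)" "form x y = 1"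
  shows "br x y = dual \<alpha>"
  by (rule dual_vector_eqI[symmetric]) (use assms in \<open>auto simp: br_opposite_in_H form_br_rs\<close>)

lemma root_triple:
  assumes "\<alpha> \<in> roots scale br H"
  obtains e f where "e \<in> rs \<alpha>" "f \<in> rs (- \<alpha>)" "form e f = 1" "br e f = dual \<alpha>"
proof -
  obtain e where e: "e \<in> rs \<alpha>" "e \<noteq> 0"
    using assms subspace_0[OF rs_subspace, of \<alpha>] by (auto simp: roots_def)
  have "\<alpha> \<in> dual_space scale H"
    using assms by (simp add: roots_def)
  then obtain f where f: "f \<in> rs (- \<alpha>)" "form e f = 1"
    using rs_dual_element e by blast
  show ?thesis
    using that[OF e(1) f] br_opposite_eq_dual[OF e(1) f] by simp
qed

text \<open>For a root, the representing vector is exhibited as a bracket of normalised opposite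
  root vectors, so the description operator is justified.\<close>

lemma dual_vector_root:
  assumes "\<alpha> \<in> roots scale br H"
  shows "dual \<alpha> \<in> H" "h \<in> H \<Longrightarrow> form (dual \<alpha>) h = \<alpha> h"
proof -
  obtain e f where ef: "e \<in> rs \<alpha>" "f \<in> rs (- \<alpha>)" "form e f = 1" "br e f = dual \<alpha>"
    using root_triple[OF assms] .
  show "dual \<alpha> \<in> H"
    using br_opposite_in_H[OF ef(1,2)] ef(4) by simp
  show "form (dual \<alpha>) h = \<alpha> h" if "h \<in> H"
    using form_br_rs[OF ef(2) that, of e] ef(3,4) by simp
qed

lemma nonisotropicD:
  assumes "\<alpha> \<in> nonisotropic"
  shows "\<alpha> \<in> roots scale br H" "\<alpha> \<in> dual_space scale H" "\<alpha> (dual \<alpha>) \<noteq> 0"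
proof -
  show "\<alpha> \<in> roots scale br H" "\<alpha> \<in> dual_space scale H"
    using assms by (auto simp: nonisotropic_roots_def roots_def)
  then show "\<alpha> (dual \<alpha>) \<noteq> 0"
    using assms dual_vector_root(2)[of \<alpha> "dual \<alpha>"]
    by (auto simp: nonisotropic_roots_def dual_form_def dual_vector_root)
qed

lemma dual_form_root:
  assumes "\<alpha> \<in> roots scale br H" "\<beta> \<in> roots scale br H"
  shows "dual_form form H \<alpha> \<beta> = \<beta> (dual \<alpha>)"
  unfolding dual_form_def
  using dual_vector_root[OF assms(1)] dual_vector_root[OF assms(2)] by (metis form_sym)

section \<open>The core\<close>

lemma core_lie_ideal: "lie_ideal scale br K"
  unfolding core_def by (rule lie_ideal_hull)

lemma core_subspace: "subspace K"
  using core_lie_ideal by (simp add: lie_ideal_def)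

lemma br_core: "y \<in> K \<Longrightarrow> br x y \<in> K" "y \<in> K \<Longrightarrow> br y x \<in> K"
proof -
  show *: "br x y \<in> K" if "y \<in> K" for x y
    using that core_lie_ideal by (simp add: lie_ideal_def)
  show "br y x \<in> K" if "y \<in> K"
    using *[OF that] br_anticommute[of y x] subspace_neg[OF core_subspace] by simp
qed

lemma rs_subset_core: "\<alpha> \<in> nonisotropic \<Longrightarrow> x \<in> rs \<alpha> \<Longrightarrow> x \<in> K"
  unfolding core_def by (rule hull_inc) auto

lemma dual_in_core:
  assumes "\<alpha> \<in> nonisotropic"
  shows "dual \<alpha> \<in> K"
proof -
  obtain e f where "e \<in> rs \<alpha>" "br e f = dual \<alpha>"
    using root_triple[OF nonisotropicD(1)[OF assms]] by metis
  then show ?thesis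
    using br_core(2)[OF rs_subset_core[OF assms]] by metis
qed

text \<open>\<open>b\<close> is a multiple of its bracket with \<open>dual \<alpha>\<close>, which
  lies in \<open>K\<close>. This also covers weight -\<alpha> without first showing that -\<alpha>
  is a nonisotropic root.\<close>

lemma rs_in_core:
  assumes "\<alpha> \<in> nonisotropic" "b \<in> rs \<beta>" "\<beta> (dual \<alpha>) \<noteq> 0"
  shows "b \<in> K"
proof -
  have "b = scale (1 / \<beta> (dual \<alpha>)) (br (dual \<alpha>) b)"
    using assms rs_bracket[OF assms(2) dual_vector_root(1)[OF nonisotropicD(1)[OF assms(1)]]]
    by simp
  then show ?thesis
    using br_core(2)[OF dual_in_core[OF assms(1)]] subspace_scale[OF core_subspace] by metis
qed

text \<open>
  A vector orthogonal to \<open>f\<close> would be a lowest weight vector of positive weight for the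
  \<open>sl\<^sub>2\<close>-triple through \<open>e\<close> and \<open>f\<close>, on which \<open>ad e\<close> cannot be nilpotent.
\<close>

lemma nonisotropic_rs_one_dim:
  assumes \<alpha>: "\<alpha> \<in> nonisotropic"
    and e: "e \<in> rs \<alpha>" and f: "f \<in> rs (- \<alpha>)" and ef: "form e f = 1"
    and x: "x \<in> rs \<alpha>"
  shows "x = scale (form x f) e"
proof (rule ccontr)
  assume neq: "x \<noteq> scale (form x f) e"
  \<comment> \<open>Subtracting the multiple of \<open>e\<close> with the same pairing against
    \<open>f\<close> makes \<open>v\<close> orthogonal to \<open>f\<close>.\<close>
  define v where "v = x - scale (form x f) e"
  have v: "v \<noteq> 0" "v \<in> rs \<alpha>"
    using neq x e rs_subspace[of \<alpha>] by (auto simp: v_def subspace_diff subspace_scale)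
  define t q where "t = dual \<alpha>" and "q = \<alpha> t"
  have t: "br e f = t" "t \<in> H" "q \<noteq> 0"
    using br_opposite_eq_dual[OF e f ef] br_opposite_in_H[OF e f] nonisotropicD(3)[OF \<alpha>]
    by (auto simp: t_def q_def)
  have "form v f = 0"
    using form_add_left[of v "scale (form x f) e" f] by (simp add: v_def form_scale_left ef)
  \<comment> \<open>The bracket of \<open>v\<close> and \<open>f\<close> lies in \<open>H\<close>
    and pairs with \<open>h\<close> to \<alpha>(h) times the pairing of \<open>v\<close> and
    \<open>f\<close>, so nondegeneracy on \<open>H\<close> kills it.\<close>
  then have "form (br v f) h = 0" if "h \<in> H" for h
    using form_br_rs[OF f that, of v] by simp
  then have vf: "br v f = 0"
    using H_form_nondegenerate[of "br v f"] br_opposite_in_H[OF v(2) f] by blast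
  define w where "w n = (br e ^^ n) v" for n
  have w_Suc: "w (Suc n) = br e (w n)" and w_0: "w 0 = v" for n
    by (simp_all add: w_def)
  have tw: "br t (w n) = scale (of_nat (Suc n) * q) (w n)" for n
  proof (induction n)
    case 0
    show ?case
      using rs_bracket[OF v(2) t(2)] by (simp add: w_0 q_def)
  next
    case (Suc n)
    have "br t (w (Suc n)) = br (br t e) (w n) + br e (br t (w n))"
      by (simp only: w_Suc br_leibniz[of t e])
    then show ?case
      using rs_bracket[OF e t(2)] Suc
      by (simp add: q_def br_scale_left br_scale_right w_Suc[symmetric] scale_left_distrib[symmetric])
        (simp add: algebra_simps)
  qed
  have fe: "br f e = - t"
    using t(1) br_anticommute by metis
  \<comment> \<open>Since \<open>f\<close> kills \<open>v\<close> and its bracket with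
    \<open>e\<close> is \<open>-t\<close>, moving \<open>f\<close> past successive copies of
    \<open>e\<close> adds up the \<open>t\<close>-weights q, 2q, ..., (n+1)q with a minus
    sign.\<close>
  have fw: "br f (w (Suc n)) = scale (- (\<Sum>i\<le>n. of_nat (Suc i)) * q) (w n)" for n
  proof (induction n)
    case 0
    have "br f (w 1) = br (br f e) v + br e (br f v)"
      by (simp only: w_Suc w_0 br_leibniz[of f e] One_nat_def)
    moreover have "br f v = 0"
      using vf br_anticommute[of f v] by simp
    ultimately show ?case
      using tw[of 0] by (simp add: fe br_minus_left w_0)
  next
    case (Suc n)
    have "br f (w (Suc (Suc n))) = br (br f e) (w (Suc n)) + br e (br f (w (Suc n)))"
      by (simp only: w_Suc[of "Suc n"] br_leibniz[of f e])
    also have "\<dots> = scale (- of_nat (Suc (Suc n)) * q) (w (Suc n))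
        + scale (- (\<Sum>i\<le>n. of_nat (Suc i)) * q) (w (Suc n))"
      by (simp only: fe br_minus_left tw Suc br_scale_right w_Suc[symmetric] mult_minus_left scale_minus_left br_minus_right)
    also have "\<dots> = scale (- (\<Sum>i\<le>Suc n. of_nat (Suc i)) * q) (w (Suc n))"
      by (simp only: scale_left_distrib[symmetric] sum.atMost_Suc distrib_right minus_add_distrib add.commute)
    finally show ?case .
  qed
  have "w n \<noteq> 0" for n
  proof (induction n)
    case 0
    show ?case using v(1) by (simp add: w_0)
  next
    case (Suc n)
    \<comment> \<open>The coefficient comes from a positive integer, which stays nonzero in
      characteristic 0.\<close>
    have "(\<Sum>i\<le>n. of_nat (Suc i) :: 'f) = of_nat (\<Sum>i\<le>n. Suc i)"
      by simp
    also have "\<dots> \<noteq> 0"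
      by (simp only: of_nat_eq_0_iff) auto
    finally have "br f (w (Suc n)) \<noteq> 0"
      using Suc t(3) by (simp only: fw scale_eq_0_iff) auto
    then show ?case by auto
  qed
  moreover obtain n where "w n = 0"
    using ad_locally_nilpotent[OF \<alpha> e, of v] by (auto simp: w_def)
  ultimately show False by blast
qed

text \<open>The centralizer of the zero ideal is everything while its centre is zero, so by tameness
  a zero core would force the whole algebra, and with it \<open>H\<close>, to be zero.\<close>

lemma core_nontrivial: "\<exists>x\<in>K. x \<noteq> 0"
proof (rule ccontr)
  assume "\<not> ?thesis"
  then have "K = {0}"
    using subspace_0[OF core_subspace] by auto
  then have "UNIV = {0::'e}"
    using tame by (auto simp: centralizer_def centre_def)
  moreover have "0 \<in> H"
    using H_subalgebra by (auto simp: lie_subalgebra_def subspace_def)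
  ultimately have "H = {0}"
    by blast
  then show False
    using H_nonzero by simp
qed

text \<open>For nonzero \<open>g\<close> of weight \<alpha>, a partner \<open>f\<close> scaled by
  the inverse of \<alpha>(\<open>dual \<alpha>\<close>) gives an element \<open>c\<close> of
  \<open>K\<close> with \<open>g = br (br g c) g\<close>. This is the factorisation demanded by the
  hull lemmas on centroidal maps.\<close>

lemma gens_perfect:
  assumes "g \<in> gens"
  shows "\<exists>a\<in>gens. \<exists>b\<in>gens. \<exists>c\<in>K. g = br (br a c) b"
proof (cases "g = 0")
  case True
  then show ?thesis
    using assms subspace_0[OF core_subspace] by (metis br_zero_right)
next
  case False
  obtain \<alpha> where \<alpha>: "\<alpha> \<in> nonisotropic" "g \<in> rs \<alpha>"
    using assms by blast
  note D = nonisotropicD[OF \<alpha>(1)]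
  obtain f where f: "f \<in> rs (- \<alpha>)" "form g f = 1"
    using rs_dual_element[OF D(2) \<alpha>(2) False] .
  let ?s = "1 / \<alpha> (dual \<alpha>)"
  have "br (br g (scale ?s f)) g = scale ?s (br (dual \<alpha>) g)"
    using br_opposite_eq_dual[OF \<alpha>(2) f] by (simp add: br_scale_left br_scale_right)
  also have "\<dots> = g"
    using rs_bracket[OF \<alpha>(2) dual_vector_root(1)[OF D(1)]] D(3) by simp
  finally have "g = br (br g (scale ?s f)) g" ..
  moreover have "scale ?s f \<in> K"
    using rs_in_core[OF \<alpha>(1) f(1)] D(3) subspace_scale[OF core_subspace] by simp
  ultimately show ?thesis
    using assms by blast
qed

section \<open>The centroid of the core\<close>

lemma centroidal_preserves_rs:
  assumes \<chi>: "centroidal_on K \<chi>" and \<alpha>: "\<alpha> \<in> nonisotropic" and x: "x \<in> rs \<alpha>"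
  shows "\<chi> x \<in> rs \<alpha>"
proof (rule mem_rsI)
  fix \<beta> b
  assume \<beta>: "\<beta> \<in> dual_space scale H" and b: "b \<in> rs (- \<beta>)" and nz: "form (\<chi> x) b \<noteq> 0"
  let ?t = "dual \<alpha>"
  note D = nonisotropicD[OF \<alpha>]
  have t: "?t \<in> H" "?t \<in> K"
    using dual_vector_root(1)[OF D(1)] dual_in_core[OF \<alpha>] by auto
  have xK: "x \<in> K"
    using rs_subset_core[OF \<alpha> x] .
  have "br ?t (\<chi> x) = scale (\<alpha> ?t) (\<chi> x)"
    using centroidal_onD(4)[OF \<chi> t(2) xK] centroidal_onD(1)[OF \<chi> xK] rs_bracket[OF x t(1)] by simp
  then have "\<alpha> ?t * form (\<chi> x) b = form (br ?t (\<chi> x)) b"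
    by (simp add: form_scale_left)
  also have "\<dots> = form (br (\<chi> x) b) ?t"
    by (metis form_invariant form_sym)
  also have "\<dots> = \<beta> ?t * form (\<chi> x) b"
    using form_br_rs[OF b t(1)] .
  finally have \<beta>t: "\<beta> ?t = \<alpha> ?t"
    using nz by simp
  then have bK: "b \<in> K"
    using rs_in_core[OF \<alpha> b] D(3) by simp
  have *: "\<beta> h * form (\<chi> x) b = \<alpha> h * form x (\<chi> b)" if h: "h \<in> H" for h
  proof -
    have "\<beta> h * form (\<chi> x) b = form (br (\<chi> x) b) h"
      using form_br_rs[OF b h] by simp
    also have "br (\<chi> x) b = br x (\<chi> b)"
      using centroidal_onD(4,5)[OF \<chi> xK bK] by simp
    also have "form (br x (\<chi> b)) h = form (br h x) (\<chi> b)"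
      by (metis form_invariant form_sym)
    finally show ?thesis
      using rs_bracket[OF x h] by (simp add: form_scale_left)
  qed
  \<comment> \<open>Taking \<open>h\<close> to be \<open>dual \<alpha>\<close>, where both
    functionals take the same nonzero value, shows that the factor of proportionality is 1.\<close>
  have "form (\<chi> x) b = form x (\<chi> b)"
    using *[OF t(1)] \<beta>t D(3) by simp
  then have "\<beta> h = \<alpha> h" if "h \<in> H" for h
    using *[OF that] nz by simp
  moreover have "\<beta> h = \<alpha> h" if "h \<notin> H" for h
    using \<beta> D(2) that by (simp add: dual_space_def)
  ultimately show "\<beta> = \<alpha>"
    by (intro ext) (rule case_split)
qed

text \<open>The same scalar serves \<open>dual \<alpha>\<close> because this vector is the bracket
  of \<open>e\<close> and \<open>f\<close>, and \<chi> may be applied to \<open>e\<close>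
  alone.\<close>

lemma centroidal_scalar_on_rs:
  assumes \<chi>: "centroidal_on K \<chi>" and \<alpha>: "\<alpha> \<in> nonisotropic"
  obtains c where "\<And>x. x \<in> rs \<alpha> \<Longrightarrow> \<chi> x = scale c x" "\<chi> (dual \<alpha>) = scale c (dual \<alpha>)"
proof -
  note D = nonisotropicD[OF \<alpha>]
  obtain e f where ef: "e \<in> rs \<alpha>" "f \<in> rs (- \<alpha>)" "form e f = 1" "br e f = dual \<alpha>"
    using root_triple[OF D(1)] .
  have K: "e \<in> K" "f \<in> K"
    using rs_subset_core[OF \<alpha> ef(1)] rs_in_core[OF \<alpha> ef(2)] D(3) by auto
  define c where "c = form (\<chi> e) f"
  have e: "\<chi> e = scale c e"
    unfolding c_def
    by (rule nonisotropic_rs_one_dim[OF \<alpha> ef(1-3) centroidal_preserves_rs[OF \<chi> \<alpha> ef(1)]])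
  have "\<chi> x = scale c x" if "x \<in> rs \<alpha>" for x
  proof -
    have x: "x = scale (form x f) e"
      by (rule nonisotropic_rs_one_dim[OF \<alpha> ef(1-3) that])
    have "\<chi> (scale (form x f) e) = scale c (scale (form x f) e)"
      by (simp add: centroidal_onD(1)[OF \<chi> K(1)] e mult.commute)
    then show ?thesis
      by (simp only: x[symmetric])
  qed
  moreover have "\<chi> (dual \<alpha>) = scale c (dual \<alpha>)"
    using centroidal_onD(5)[OF \<chi> K] by (simp add: ef(4)[symmetric] e br_scale_left)
  ultimately show ?thesis
    using that by blast
qed

lemma centroidal_core_scalar:
  assumes \<chi>: "centroidal_on K \<chi>"
  shows "\<exists>c. \<forall>x\<in>K. \<chi> x = scale c x"
proof -
  have "\<forall>\<alpha>\<in>nonisotropic. \<exists>c. (\<forall>x\<in>rs \<alpha>. \<chi> x = scale c x) \<and> \<chi> (dual \<alpha>) = scale c (dual \<alpha>)"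
    by (rule ballI, rule centroidal_scalar_on_rs[OF \<chi>]) auto
  from bchoice[OF this] obtain c
    where c: "\<And>\<alpha> x. \<alpha> \<in> nonisotropic \<Longrightarrow> x \<in> rs \<alpha> \<Longrightarrow> \<chi> x = scale (c \<alpha>) x"
      and c_dual: "\<And>\<alpha>. \<alpha> \<in> nonisotropic \<Longrightarrow> \<chi> (dual \<alpha>) = scale (c \<alpha>) (dual \<alpha>)"
    by blast
  have adj: "c \<alpha> = c \<beta>"
    if \<alpha>: "\<alpha> \<in> nonisotropic" and \<beta>: "\<beta> \<in> nonisotropic" and nz: "dual_form form H \<alpha> \<beta> \<noteq> 0" for \<alpha> \<beta>
  proof -
    obtain e where e: "e \<in> rs \<beta>" "e \<noteq> 0"
      using \<beta> subspace_0[OF rs_subspace, of \<beta>]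
      by (auto simp: nonisotropic_roots_def roots_def)
    have br: "br (dual \<alpha>) e = scale (\<beta> (dual \<alpha>)) e"
      using rs_bracket[OF e(1) dual_vector_root(1)[OF nonisotropicD(1)[OF \<alpha>]]] .
    have "br (\<chi> (dual \<alpha>)) e = br (dual \<alpha>) (\<chi> e)"
      using centroidal_onD(4,5)[OF \<chi> dual_in_core[OF \<alpha>] rs_subset_core[OF \<beta> e(1)]] by simp
    then have "scale (c \<alpha> * \<beta> (dual \<alpha>)) e = scale (c \<beta> * \<beta> (dual \<alpha>)) e"
      by (simp add: c_dual[OF \<alpha>] c[OF \<beta> e(1)] br br_scale_left br_scale_right)
    moreover have "\<beta> (dual \<alpha>) \<noteq> 0"
      using nz dual_form_root[OF nonisotropicD(1)[OF \<alpha>] nonisotropicD(1)[OF \<beta>]] by simp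
    ultimately show ?thesis
      using e(2) by simp
  qed
  obtain c0 where c0: "\<And>\<alpha>. \<alpha> \<in> nonisotropic \<Longrightarrow> c \<alpha> = c0"
  proof (cases "nonisotropic = {}")
    case False
    then obtain \<alpha>0 where \<alpha>0: "\<alpha>0 \<in> nonisotropic" by blast
    \<comment> \<open>Roots are split by whether they carry the scalar of \<alpha>0. By
      \<open>adj\<close> the two classes are orthogonal, so connectedness empties the
      second.\<close>
    let ?A = "{\<alpha> \<in> nonisotropic. c \<alpha> = c \<alpha>0}" and ?B = "{\<alpha> \<in> nonisotropic. c \<alpha> \<noteq> c \<alpha>0}"
    have "?B = {}"
    proof (rule ccontr)
      assume B: "?B \<noteq> {}"
      have A: "?A \<noteq> {}"
        using \<alpha>0 by auto
      have orth: "\<forall>\<alpha>\<in>?A. \<forall>\<beta>\<in>?B. dual_form form H \<alpha> \<beta> = 0"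
      proof (intro ballI)
        fix \<alpha> \<beta>
        assume "\<alpha> \<in> ?A" "\<beta> \<in> ?B"
        then show "dual_form form H \<alpha> \<beta> = 0"
          using adj[of \<alpha> \<beta>] by (cases "dual_form form H \<alpha> \<beta> = 0") simp_all
      qed
      have AB: "?A \<inter> ?B = {}" "?A \<union> ?B = nonisotropic"
        by auto
      show False
        by (rule notE[OF nonisotropic_connected], rule exI[of _ ?A], rule exI[of _ ?B])
          (rule conjI[OF A conjI[OF B conjI[OF AB(1) conjI[OF AB(2) orth]]]])
    qed
    then have "c \<alpha> = c \<alpha>0" if "\<alpha> \<in> nonisotropic" for \<alpha>
      using that by blast
    then show ?thesis
      by (rule that)
  next
    \<comment> \<open>With no nonisotropic roots any value of \<open>c0\<close> meets the condition;
      0 is an arbitrary default.\<close>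
    case True
    show ?thesis
      by (rule that[of 0]) (simp add: True)
  qed
  have gens0: "\<chi> g - scale c0 g = 0" if g: "g \<in> gens" for g
  proof -
    obtain \<alpha> where "\<alpha> \<in> nonisotropic" "g \<in> rs \<alpha>"
      using g by blast
    then show ?thesis
      using c[of \<alpha> g] c0[of \<alpha>] by simp
  qed
  \<comment> \<open>The difference of \<chi> and the scalar is again centroidal and kills the
    generators.\<close>
  have "\<chi> x - scale c0 x = 0" if "x \<in> K" for x
    by (rule centroidal_on_eq_0[OF gens_perfect[unfolded core_def] that[unfolded core_def]
          centroidal_on_diff_scale[OF \<chi> core_lie_ideal, of c0, unfolded core_def] gens0])
  then have "\<forall>x\<in>K. \<chi> x = scale c0 x"
    by simp
  then show ?thesis ..
qed

text \<open>Nontriviality of the core makes the scalar by which a map acts on it unique; this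
  underlies \<open>coeff\<close> and the directness of the sum.\<close>

lemma core_scale_cancel:
  assumes "\<And>x. x \<in> K \<Longrightarrow> scale c x = scale d x"
  shows "c = d"
proof -
  obtain x where "x \<in> K" "x \<noteq> 0"
    using core_nontrivial by blast
  then show ?thesis
    using assms[of x] by simp
qed

lemma centroid_core: "centroid scale br K = scalar_maps scale K"
proof (intro equalityI subsetI)
  fix \<chi>
  assume \<chi>: "\<chi> \<in> centroid scale br K"
  then have "centroidal_on K \<chi>"
    by (simp add: centroid_iff)
  from centroidal_core_scalar[OF this] obtain c where "\<forall>x\<in>K. \<chi> x = scale c x" ..
  then have "\<chi> = (\<lambda>x. if x \<in> K then scale c x else 0)"
    using \<chi> by (auto simp: centroid_iff)
  then show "\<chi> \<in> scalar_maps scale K"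
    by (auto simp: scalar_maps_def)
next
  fix \<chi>
  assume "\<chi> \<in> scalar_maps scale K"
  then obtain c where "\<chi> = (\<lambda>x. if x \<in> K then scale c x else 0)"
    by (auto simp: scalar_maps_def)
  then show "\<chi> \<in> centroid scale br K"
    using core_subspace br_core
    by (auto simp: centroid_def linear_on_def subspace_add subspace_scale scale_right_distrib
        br_scale_left br_scale_right mult.commute)
qed

section \<open>The centroid of the whole algebra\<close>

lemma centroid_scalar_on_core:
  assumes "\<chi> \<in> centroid scale br UNIV"
  shows "\<exists>c. \<forall>x\<in>K. \<chi> x = scale c x"
proof -
  have \<chi>: "centroidal_on UNIV \<chi>"
    using assms by (simp add: centroid_iff)
  have "\<chi> x \<in> K" if "x \<in> K" for x
    unfolding core_def
    by (rule centroidal_maps_into_hull[OF gens_perfect[unfolded core_def] \<chi> that[unfolded core_def]])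
  then have "centroidal_on K \<chi>"
    using \<chi> unfolding centroidal_on_def linear_on_def by blast
  then show ?thesis
    by (rule centroidal_core_scalar)
qed

lemma scalar_maps_UNIV: "scalar_maps scale UNIV = range scale"
  by (simp add: scalar_maps_def)

text \<open>For \<open>k\<close> in \<open>K\<close>, the bracket of \<chi>(x) with \<open>k\<close>
  is \<chi> of an element of the ideal \<open>K\<close>, hence 0; tameness turns centralizing
  \<open>K\<close> into lying in its centre.\<close>

lemma centroid_vanishing_in_centre:
  assumes "\<chi> \<in> centroid_vanishing scale br K"
  shows "\<chi> x \<in> centre br K"
proof -
  have \<chi>: "centroidal_on UNIV \<chi>" "\<And>k. k \<in> K \<Longrightarrow> \<chi> k = 0"
    using assms by (auto simp: centroid_vanishing_def centroid_iff)
  have "br (\<chi> x) k = 0" if "k \<in> K" for k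
    using centroidal_onD(5)[OF \<chi>(1), of x k] \<chi>(2)[OF br_core(1)[OF that]] by simp
  then show ?thesis
    unfolding tame[symmetric] by (simp add: centralizer_def)
qed

section \<open>Splitting the centroid into scalars and maps vanishing on the core\<close>

lemma scalar_plus_vanishing_in_centroid:
  assumes "\<nu> \<in> centroid_vanishing scale br K"
  shows "scale c + \<nu> \<in> centroid scale br UNIV"
proof -
  have "centroidal_on UNIV \<nu>"
    using assms by (simp add: centroid_vanishing_def centroid_iff)
  note D = centroidal_onD[OF this UNIV_I]
  have "br x (\<nu> y) = br (\<nu> x) y" for x y
    using D(4,5) by simp
  then show ?thesis
    by (simp add: centroid_def linear_on_def D(1,3,5) scale_right_distrib br_scale_left
        br_scale_right br_add_left br_add_right ac_simps)
qed

text \<open>On the centroid this is the projection to the scalar summand; the description is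
  meaningful by \<open>centroid_scalar_on_core\<close> and \<open>core_scale_cancel\<close>.\<close>

definition coeff :: "('e \<Rightarrow> 'e) \<Rightarrow> 'f" where
  "coeff \<chi> = (THE c. \<forall>x\<in>K. \<chi> x = scale c x)"

lemma coeff_eqI: "(\<And>x. x \<in> K \<Longrightarrow> \<chi> x = scale c x) \<Longrightarrow> coeff \<chi> = c"
  unfolding coeff_def by (rule the_equality) (auto intro: core_scale_cancel)

lemma coeff_core: "\<chi> \<in> centroid scale br UNIV \<Longrightarrow> x \<in> K \<Longrightarrow> \<chi> x = scale (coeff \<chi>) x"
proof -
  assume \<chi>: "\<chi> \<in> centroid scale br UNIV" and x: "x \<in> K"
  from centroid_scalar_on_core[OF \<chi>] obtain c where c: "\<forall>x\<in>K. \<chi> x = scale c x" ..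
  then have "coeff \<chi> = c"
    by (intro coeff_eqI) simp
  then show "\<chi> x = scale (coeff \<chi>) x"
    using c x by simp
qed

lemma coeff_scalar_plus_vanishing:
  "\<nu> \<in> centroid_vanishing scale br K \<Longrightarrow> coeff (scale c + \<nu>) = c"
  by (rule coeff_eqI) (simp add: centroid_vanishing_def)

lemma coeff_vanishing: "\<nu> \<in> centroid_vanishing scale br K \<Longrightarrow> coeff \<nu> = 0"
  by (rule coeff_eqI) (simp add: centroid_vanishing_def)

lemma coeff_scale: "coeff (scale c) = c"
  by (rule coeff_eqI) simp

definition vanishing_part :: "('e \<Rightarrow> 'e) \<Rightarrow> 'e \<Rightarrow> 'e" where
  "vanishing_part \<chi> = (\<lambda>x. \<chi> x - scale (coeff \<chi>) x)"

lemma vanishing_part: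
  assumes "\<chi> \<in> centroid scale br UNIV"
  shows "vanishing_part \<chi> \<in> centroid_vanishing scale br K"
  using assms centroidal_on_diff_scale[of UNIV \<chi> "coeff \<chi>"] coeff_core[OF assms]
  by (auto simp: centroid_vanishing_def centroid_iff vanishing_part_def lie_ideal_def)

lemma scale_plus_vanishing_part: "scale (coeff \<chi>) + vanishing_part \<chi> = \<chi>"
  by (auto simp: vanishing_part_def)

lemma vanishing_part_vanishing: "\<nu> \<in> centroid_vanishing scale br K \<Longrightarrow> vanishing_part \<nu> = \<nu>"
  by (auto simp: vanishing_part_def coeff_vanishing)

lemma centroid_eq: "centroid scale br UNIV = scalar_maps scale UNIV + centroid_vanishing scale br K"
proof (intro equalityI subsetI)
  fix \<chi>
  assume \<chi>: "\<chi> \<in> centroid scale br UNIV"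
  show "\<chi> \<in> scalar_maps scale UNIV + centroid_vanishing scale br K"
    by (subst scale_plus_vanishing_part[symmetric], rule set_plus_intro)
      (auto simp: scalar_maps_UNIV vanishing_part[OF \<chi>])
next
  fix \<chi>
  assume "\<chi> \<in> scalar_maps scale UNIV + centroid_vanishing scale br K"
  then show "\<chi> \<in> centroid scale br UNIV"
    by (auto simp: scalar_maps_UNIV set_plus_def intro: scalar_plus_vanishing_in_centroid)
qed

lemma zero_in_centroid_vanishing: "0 \<in> centroid_vanishing scale br K"
  by (auto simp: centroid_vanishing_def centroid_def linear_on_def)

lemma scalar_maps_Int_vanishing: "scalar_maps scale UNIV \<inter> centroid_vanishing scale br K = {0}"
proof -
  have "\<nu> = 0" if "\<nu> \<in> centroid_vanishing scale br K" "\<nu> = scale c" for \<nu> c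
    using coeff_vanishing[OF that(1)] that(2) by (auto simp: coeff_scale)
  moreover have "0 \<in> range scale"
    by (rule range_eqI[of _ _ 0]) auto
  ultimately show ?thesis
    using zero_in_centroid_vanishing by (auto simp: scalar_maps_UNIV)
qed

section \<open>Passing to the quotient by the core\<close>

lemma mem_own_coset: "a \<in> a +o K"
  using subspace_0[OF core_subspace] by (auto simp: elt_set_plus_def)

text \<open>The map induced on cosets, evaluated at a chosen representative; the value 0 elsewhere
  matches the convention of \<open>hom_quotient_centre\<close>.\<close>

definition descend :: "('e \<Rightarrow> 'e) \<Rightarrow> 'e set \<Rightarrow> 'e" where
  "descend \<nu> X = (if X \<in> range (\<lambda>a. a +o K) then \<nu> (SOME a. a +o K = X) else 0)"

text \<open>Two representatives differ by an element of \<open>K\<close>, which \<nu> kills.\<close>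

lemma descend_coset:
  assumes "\<nu> \<in> centroid_vanishing scale br K"
  shows "descend \<nu> (a +o K) = \<nu> a"
proof -
  define b where "b = (SOME b. b +o K = a +o K)"
  have "b +o K = a +o K"
    unfolding b_def by (rule someI[of _ a]) simp
  then obtain k where k: "k \<in> K" "a = b + k"
    using mem_own_coset[of a] unfolding elt_set_plus_def by blast
  then have "\<nu> a = \<nu> b"
    using assms by (auto simp: centroid_vanishing_def centroid_def linear_on_def)
  then show ?thesis
    by (simp add: descend_def b_def)
qed

lemma descend_in_hom:
  assumes "\<nu> \<in> centroid_vanishing scale br K"
  shows "descend \<nu> \<in> hom_quotient_centre scale br K"
proof -
  have "centroidal_on UNIV \<nu>"
    using assms by (simp add: centroid_vanishing_def centroid_iff)
  note D = centroidal_onD[OF this UNIV_I]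
  have "br x (\<nu> y) = br (\<nu> x) y" for x y
    using D(4,5) by simp
  then show ?thesis
    using centroid_vanishing_in_centre[OF assms]
    by (auto simp: hom_quotient_centre_def descend_coset[OF assms] D(1,3,5)) (auto simp: descend_def)
qed

lemma hom_lift_vanishing:
  assumes "f \<in> hom_quotient_centre scale br K"
  shows "(\<lambda>a. f (a +o K)) \<in> centroid_vanishing scale br K"
proof -
  have f: "f ((a + b) +o K) = f (a +o K) + f (b +o K)" "f (scale c a +o K) = scale c (f (a +o K))"
    "f (br a b +o K) = br (f (a +o K)) b" "f (br a b +o K) = br a (f (b +o K))" for a b c
    using assms unfolding hom_quotient_centre_def by blast+
  have "f (x +o K) = 0" if "x \<in> K" for x
  proof -
    have "x +o K = 0 +o K"
    proof (intro equalityI subsetI)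
      fix y
      assume "y \<in> 0 +o K"
      then have "y - x \<in> K"
        using that by (auto simp: elt_set_plus_def intro: subspace_diff[OF core_subspace])
      then show "y \<in> x +o K"
        by (auto simp: elt_set_plus_def intro!: bexI[of _ "y - x"])
    qed (use that in \<open>auto simp: elt_set_plus_def intro: subspace_add[OF core_subspace]\<close>)
    \<comment> \<open>Homogeneity with scalar 0 makes \<open>f\<close> vanish on the zero
      coset.\<close>
    then show ?thesis
      using f(2)[of 0 0] by simp
  qed
  moreover have "(\<lambda>a. f (a +o K)) \<in> centroid scale br UNIV"
    unfolding centroid_def linear_on_def using f(1,2) f(3,4) by blast
  ultimately show ?thesis
    by (simp add: centroid_vanishing_def)
qed

lemma descend_lift:
  assumes "f \<in> hom_quotient_centre scale br K"
  shows "descend (\<lambda>a. f (a +o K)) = f"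
proof
  fix X
  show "descend (\<lambda>a. f (a +o K)) X = f X"
  proof (cases "X \<in> range (\<lambda>a. a +o K)")
    case True
    then show ?thesis
      using descend_coset[OF hom_lift_vanishing[OF assms]] by auto
  next
    case False
    then show ?thesis
      using assms by (simp add: descend_def hom_quotient_centre_def)
  qed
qed

section \<open>The isomorphism\<close>

definition centroid_iso :: "('e \<Rightarrow> 'e) \<Rightarrow> ('e \<Rightarrow> 'e) \<times> ('e set \<Rightarrow> 'e)" where
  "centroid_iso \<chi> = (scale (coeff \<chi>), descend (vanishing_part \<chi>))"

lemma centroid_iso_scale: "centroid_iso (scale c) = (scale c, 0)"
  by (auto simp: centroid_iso_def coeff_scale vanishing_part_def descend_def)

lemma centroid_iso_vanishing:
  "\<nu> \<in> centroid_vanishing scale br K \<Longrightarrow> centroid_iso \<nu> = (0, descend \<nu>)"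
  by (auto simp: centroid_iso_def coeff_vanishing vanishing_part_vanishing)

text \<open>Uniqueness of the scalar makes \<open>coeff\<close> linear on the centroid. The
  representative chosen in \<open>descend\<close> depends on the coset alone, so
  \<open>descend\<close> is pointwise linear.\<close>

lemma centroid_iso_linear:
  "linear_on (scale_fun scale) (scale_prod (scale_fun scale) (scale_fun scale))
     (centroid scale br UNIV) centroid_iso"
proof -
  have add: "coeff (\<chi> + \<psi>) = coeff \<chi> + coeff \<psi>"
    if "\<chi> \<in> centroid scale br UNIV" "\<psi> \<in> centroid scale br UNIV" for \<chi> \<psi>
    by (rule coeff_eqI) (simp add: coeff_core[OF that(1)] coeff_core[OF that(2)] scale_left_distrib)
  have mult: "coeff (\<lambda>x. scale c (\<chi> x)) = c * coeff \<chi>" if "\<chi> \<in> centroid scale br UNIV" for \<chi> c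
    by (rule coeff_eqI) (simp add: coeff_core[OF that])
  show ?thesis
    unfolding linear_on_def centroid_iso_def
    by (auto simp: add mult scale_prod_def fun_eq_iff vanishing_part_def descend_def scale_fun_def
        scale_left_distrib scale_right_diff_distrib)
qed

lemma centroid_iso_bij:
  "bij_betw centroid_iso (centroid scale br UNIV)
     (scalar_maps scale UNIV \<times> hom_quotient_centre scale br K)"
\<comment> \<open>The inverse adds the scalar map to the pullback of the second component along the
  quotient map.\<close>
proof (rule bij_betwI[where g = "\<lambda>p. fst p + (\<lambda>a. snd p (a +o K))"])
  show "centroid_iso \<in> centroid scale br UNIV \<rightarrow>
      scalar_maps scale UNIV \<times> hom_quotient_centre scale br K"
    by (auto simp: centroid_iso_def scalar_maps_UNIV intro: descend_in_hom[OF vanishing_part])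
  show "(\<lambda>p. fst p + (\<lambda>a. snd p (a +o K))) \<in>
      scalar_maps scale UNIV \<times> hom_quotient_centre scale br K \<rightarrow> centroid scale br UNIV"
    by (auto simp: scalar_maps_UNIV intro: scalar_plus_vanishing_in_centroid[OF hom_lift_vanishing])
  show "fst (centroid_iso \<chi>) + (\<lambda>a. snd (centroid_iso \<chi>) (a +o K)) = \<chi>"
    if "\<chi> \<in> centroid scale br UNIV" for \<chi>
    by (simp add: centroid_iso_def descend_coset[OF vanishing_part[OF that]] scale_plus_vanishing_part)
  show "centroid_iso (fst p + (\<lambda>a. snd p (a +o K))) = p"
    if "p \<in> scalar_maps scale UNIV \<times> hom_quotient_centre scale br K" for p
  proof -
    obtain c f where p: "p = (scale c, f)" "f \<in> hom_quotient_centre scale br K"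
      using \<open>p \<in> _\<close> by (auto simp: scalar_maps_UNIV)
    let ?\<nu> = "\<lambda>a. f (a +o K)"
    have coeff: "coeff (scale c + ?\<nu>) = c"
      by (rule coeff_scalar_plus_vanishing[OF hom_lift_vanishing[OF p(2)]])
    have "vanishing_part (scale c + ?\<nu>) = ?\<nu>"
      unfolding vanishing_part_def coeff by auto
    then show ?thesis
      by (simp add: p(1) centroid_iso_def coeff descend_lift[OF p(2)])
  qed
qed

text \<open>Together with \<open>centroid_iso_scale\<close>, this shows that the isomorphism
  respects both summands of the decomposition.\<close>

lemma centroid_iso_image_vanishing:
  "centroid_iso ` centroid_vanishing scale br K = {0} \<times> hom_quotient_centre scale br K"
proof (intro equalityI subsetI)
  fix p :: "('e \<Rightarrow> 'e) \<times> ('e set \<Rightarrow> 'e)"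
  assume "p \<in> {0} \<times> hom_quotient_centre scale br K"
  then obtain f where f: "p = (0, f)" "f \<in> hom_quotient_centre scale br K"
    by auto
  then have "p = centroid_iso (\<lambda>a. f (a +o K))"
    using centroid_iso_vanishing[OF hom_lift_vanishing[OF f(2)]] descend_lift[OF f(2)] by simp
  then show "p \<in> centroid_iso ` centroid_vanishing scale br K"
    using hom_lift_vanishing[OF f(2)] by (rule image_eqI)
qed (auto simp: centroid_iso_vanishing descend_in_hom)

end

theorem corollary4p13:
  fixes scale :: "'f::field_char_0 \<Rightarrow> 'e::ab_group_add \<Rightarrow> 'e"
    and br :: "'e \<Rightarrow> 'e \<Rightarrow> 'e"
    and form :: "'e \<Rightarrow> 'e \<Rightarrow> 'f"
    and H K :: "'e set"
  assumes "tame_eala scale br form H"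
    and "K = core scale br form H"
  shows "centroid scale br K = scalar_maps scale K
    \<and> centroid scale br UNIV = scalar_maps scale UNIV + centroid_vanishing scale br K
    \<and> scalar_maps scale UNIV \<inter> centroid_vanishing scale br K = {0}
    \<and> (\<exists>\<Phi>. linear_iso_on
              (scale_fun scale) (centroid scale br UNIV)
              (scale_prod (scale_fun scale) (scale_fun scale))
              (scalar_maps scale UNIV \<times> hom_quotient_centre scale br K) \<Phi>
          \<and> (\<forall>\<sigma>\<in>scalar_maps scale UNIV. \<Phi> \<sigma> = (\<sigma>, 0))
          \<and> \<Phi> ` centroid_vanishing scale br K = {0} \<times> hom_quotient_centre scale br K)"
proof -
  interpret tame_eala scale br form H
    by (rule assms(1))
  show ?thesis
    unfolding assms(2) linear_iso_on_def
    using centroid_core centroid_eq scalar_maps_Int_vanishing centroid_iso_linear centroid_iso_bij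
      centroid_iso_image_vanishing centroid_iso_scale
    by (intro conjI exI[of _ centroid_iso]) (auto simp: scalar_maps_UNIV)
qed

end
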